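(* For all positive integers $a,d$ with $a<d$ there exists a sentence $\theta$ of ${\cal R}ing(0,+,*,<)$ such that for every prime $p>d$: $p\equiv a\pmod d$ if and only if $\mathbb{Z}_p\models\theta$.
   Context: For an integer $m\ge1$, $\mathbb{Z}_m$ is the finite residue class ring with universe $\{0,\ldots,m-1\}$ and addition and multiplication mod $m$. ${\cal R}ing(0,+,*,<)$ is the set of first-order formulas over a constant symbol $0$, binary function symbols $+,*$ and a binary relation symbol $<$, interpreted in $\mathbb{Z}_m$ as the residue class $0$, addition and multiplication mod $m$, and the natural order $0<1<\cdots<m-1$ of the representatives. *)

theory Defs
  imports "HOL-Number_Theory.Number_Theory"
begin

datatype tm = Var nat | Zero | Add tm tm | Mul tm tm

text \<open>Formulas of first-order logic with equality over \<open>0, +, *, <\<close>; the first argument of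
  a quantifier is the index of the bound variable.\<close>

datatype fm =
    Eq tm tm
  | Less tm tm
  | Neg fm
  | Conj fm fm
  | Disj fm fm
  | Imp fm fm
  | All nat fm
  | Exi nat fm

primrec tm_vars :: "tm \<Rightarrow> nat set" where
  "tm_vars (Var x) = {x}"
| "tm_vars Zero = {}"
| "tm_vars (Add s t) = tm_vars s \<union> tm_vars t"
| "tm_vars (Mul s t) = tm_vars s \<union> tm_vars t"

primrec free_vars :: "fm \<Rightarrow> nat set" where
  "free_vars (Eq s t) = tm_vars s \<union> tm_vars t"
| "free_vars (Less s t) = tm_vars s \<union> tm_vars t"
| "free_vars (Neg A) = free_vars A"
| "free_vars (Conj A B) = free_vars A \<union> free_vars B"
| "free_vars (Disj A B) = free_vars A \<union> free_vars B"
| "free_vars (Imp A B) = free_vars A \<union> free_vars B"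
| "free_vars (All x A) = free_vars A - {x}"
| "free_vars (Exi x A) = free_vars A - {x}"

definition sentence :: "fm \<Rightarrow> bool" where
  "sentence A \<longleftrightarrow> free_vars A = {}"

text \<open>The structure on residues mod \<open>m\<close> is the library's \<open>residue_ring (int m)\<close>, whose carrier
  is the set of integers \<open>{0..int m - 1}\<close>. Hence the integer order restricted to
  the carrier is the order of the representatives.\<close>

primrec tm_val :: "nat \<Rightarrow> (nat \<Rightarrow> int) \<Rightarrow> tm \<Rightarrow> int" where
  "tm_val m e (Var x) = e x"
| "tm_val m e Zero = \<zero>\<^bsub>residue_ring (int m)\<^esub>"
| "tm_val m e (Add s t) = tm_val m e s \<oplus>\<^bsub>residue_ring (int m)\<^esub> tm_val m e t"
| "tm_val m e (Mul s t) = tm_val m e s \<otimes>\<^bsub>residue_ring (int m)\<^esub> tm_val m e t"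

primrec sat :: "nat \<Rightarrow> (nat \<Rightarrow> int) \<Rightarrow> fm \<Rightarrow> bool" where
  "sat m e (Eq s t) \<longleftrightarrow> tm_val m e s = tm_val m e t"
| "sat m e (Less s t) \<longleftrightarrow> tm_val m e s < tm_val m e t"
| "sat m e (Neg A) \<longleftrightarrow> \<not> sat m e A"
| "sat m e (Conj A B) \<longleftrightarrow> sat m e A \<and> sat m e B"
| "sat m e (Disj A B) \<longleftrightarrow> sat m e A \<or> sat m e B"
| "sat m e (Imp A B) \<longleftrightarrow> (sat m e A \<longrightarrow> sat m e B)"
| "sat m e (All x A) \<longleftrightarrow> (\<forall>v \<in> carrier (residue_ring (int m)). sat m (e(x := v)) A)"
| "sat m e (Exi x A) \<longleftrightarrow> (\<exists>v \<in> carrier (residue_ring (int m)). sat m (e(x := v)) A)"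

text \<open>\<open>Zmod_models m A\<close> says that the structure on residues mod \<open>m\<close> satisfies \<open>A\<close>. The
  assignments range over the carrier, which is nonempty for \<open>m \<ge> 1\<close>; for a sentence the
  choice of assignment is irrelevant.\<close>

definition Zmod_models :: "nat \<Rightarrow> fm \<Rightarrow> bool" where
  "Zmod_models m A \<longleftrightarrow>
     (\<forall>e. (\<forall>x. e x \<in> carrier (residue_ring (int m))) \<longrightarrow> sat m e A)"

end

theory Submission
  imports Defs
begin

text \<open>For \<open>p > d\<close>, the congruence says \<open>p = d * x + a\<close> with some \<open>x > 0\<close>. The order
  makes this expressible modulo \<open>p\<close>: the residues of \<open>0, x, 2 * x, \<dots>, d * x\<close> are strictly
  increasing iff there is no wraparound, i.e. iff \<open>x > 0\<close> and \<open>d * x < p\<close> as integers; and then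
  \<open>0 < d * x + a < 2 * p\<close>, so \<open>d * x + a\<close> vanishes modulo \<open>p\<close> only if it equals \<open>p\<close>.\<close>

primrec times_tm :: "nat \<Rightarrow> tm \<Rightarrow> tm" where
  "times_tm 0 t = Zero"
| "times_tm (Suc n) t = Add (times_tm n t) t"

text \<open>\<open>Eq Zero Zero\<close> stands for truth, which the syntax has no symbol
  for.\<close>

primrec increasing_multiples :: "nat \<Rightarrow> tm \<Rightarrow> fm" where
  "increasing_multiples 0 t = Eq Zero Zero"
| "increasing_multiples (Suc n) t =
     Conj (increasing_multiples n t) (Less (times_tm n t) (times_tm (Suc n) t))"

text \<open>The signature has no constant 1, so \<open>Var 0\<close> is pinned down as the
  multiplicative unit; \<open>times_tm a (Var 0)\<close> is then the numeral for a. Index 1 is bound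
  twice: first as the test element for the unit, then as the quotient x.\<close>

definition congruence_sentence :: "nat \<Rightarrow> nat \<Rightarrow> fm" where
  "congruence_sentence a d =
     Exi 0 (Conj (All 1 (Eq (Mul (Var 0) (Var 1)) (Var 1)))
       (Exi 1 (Conj (increasing_multiples d (Var 1))
         (Eq (Add (times_tm d (Var 1)) (times_tm a (Var 0))) Zero))))"

lemma tm_vars_times_tm: "tm_vars (times_tm n t) \<subseteq> tm_vars t"
  by (induction n) auto

lemma free_vars_increasing_multiples: "free_vars (increasing_multiples n t) \<subseteq> tm_vars t"
  using tm_vars_times_tm by (induction n) fastforce+

lemma sentence_congruence_sentence: "sentence (congruence_sentence a d)"
  using tm_vars_times_tm[of d "Var 1"] tm_vars_times_tm[of a "Var 0"]
    free_vars_increasing_multiples[of d "Var 1"]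
  by (auto simp: sentence_def congruence_sentence_def)

lemma tm_val_times_tm: "tm_val m e (times_tm n t) = (int n * tm_val m e t) mod int m"
  by (induction n) (simp_all add: residue_ring_def mod_simps ring_distribs add.commute)

text \<open>While n * x < m, adding x < m either stays below m, where strict growth means x > 0, or
  wraps around and lands at n * x + x - m < n * x, which breaks the chain. For n = 0 the chain is
  empty and says nothing about x.\<close>

lemma sat_increasing_multiples:
  assumes "0 \<le> tm_val m e t" "tm_val m e t < int m"
  shows "sat m e (increasing_multiples n t) \<longleftrightarrow>
    n = 0 \<or> 0 < tm_val m e t \<and> int n * tm_val m e t < int m"
proof (induction n)
  case 0
  show ?case by simp
next
  case (Suc n)
  define x where "x = tm_val m e t"
  have x: "0 \<le> x" "x < int m"
    using assms by (auto simp: x_def)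
  have eq: "int (Suc n) * x = int n * x + x"
    by (simp add: algebra_simps)
  have nx: "0 \<le> int n * x"
    using x by simp
  have step: "(int n * x) mod int m < (int (Suc n) * x) mod int m \<longleftrightarrow>
      0 < x \<and> int (Suc n) * x < int m" if "int n * x < int m"
  proof (cases "int (Suc n) * x < int m")
    case True
    then show ?thesis
      using that x nx eq by (simp del: of_nat_Suc)
  next
    case False
    \<comment> \<open>Both n * x and x are below m, so a single subtraction of m reaches the
      representative.\<close>
    then have "(int (Suc n) * x - int m) mod int m = int (Suc n) * x - int m"
      using that x nx by (intro mod_pos_pos_trivial) (auto simp: eq simp del: of_nat_Suc)
    then have "(int (Suc n) * x) mod int m = int n * x + x - int m"
      by (simp add: eq del: of_nat_Suc)
    then show ?thesis
      using False that x nx by simp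
  qed
  have "sat m e (increasing_multiples (Suc n) t) \<longleftrightarrow>
      (n = 0 \<or> 0 < x \<and> int n * x < int m) \<and>
      (int n * x) mod int m < (int (Suc n) * x) mod int m"
    using Suc.IH tm_val_times_tm[of m e n t] tm_val_times_tm[of m e "Suc n" t]
    by (simp add: x_def)
  also have "\<dots> \<longleftrightarrow> 0 < x \<and> int (Suc n) * x < int m"
    using step x nx eq by auto
  finally show ?case
    by (simp add: x_def)
qed

text \<open>Testing at v = 1, a representative since 1 < m, already forces u = 1.\<close>

lemma residue_unit_iff:
  fixes m u :: int
  assumes "1 < m" "u \<in> {0..m - 1}"
  shows "(\<forall>v\<in>{0..m - 1}. (u * v) mod m = v) \<longleftrightarrow> u = 1"
proof
  assume "\<forall>v\<in>{0..m - 1}. (u * v) mod m = v"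
  then have "(u * 1) mod m = 1"
    using assms by (meson atLeastAtMost_iff le_diff_eq zero_le_one zless_imp_add1_zle add.commute)
  then show "u = 1"
    using assms by simp
qed (use assms in simp)

lemma sat_congruence_sentence:
  assumes "1 < m" "0 < d"
  shows "sat m e (congruence_sentence a d) \<longleftrightarrow>
    (\<exists>x. 0 < x \<and> int d * x < int m \<and> int m dvd int d * x + int a)"
proof -
  \<comment> \<open>Since d > 0, the bound d * x < m forces x < m, so the quantifier over residues
    can be traded for one over all integers.\<close>
  have range: "x \<in> {0..int m - 1}" if "0 < x" "int d * x < int m" for x
  proof -
    have "1 * x \<le> int d * x"
      using that assms by (intro mult_right_mono) simp_all
    then show ?thesis
      using that unfolding atLeastAtMost_iff by linarith
  qed
  have inc: "sat m (e(0 := u, Suc 0 := x)) (increasing_multiples d (Var (Suc 0))) \<longleftrightarrow>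
      0 < x \<and> int d * x < int m" if "x \<in> {0..int m - 1}" for u x
    using that assms sat_increasing_multiples[of m "e(0 := u, Suc 0 := x)" "Var (Suc 0)" d] by auto
  have one: "1 \<in> {0..int m - 1}"
    using assms by simp
  have unit: "(\<forall>v\<in>{0..int m - 1}. (u * v) mod int m = v) \<longleftrightarrow> u = 1"
    if "u \<in> {0..int m - 1}" for u
    using that assms by (intro residue_unit_iff) simp_all
  have "sat m e (congruence_sentence a d) \<longleftrightarrow>
      (\<exists>u\<in>{0..int m - 1}. (\<forall>v\<in>{0..int m - 1}. (u * v) mod int m = v) \<and>
        (\<exists>x\<in>{0..int m - 1}. (0 < x \<and> int d * x < int m) \<and>
          (int d * x + int a * u) mod int m = 0))"
    by (simp add: congruence_sentence_def inc tm_val_times_tm residue_ring_def mod_add_eq conj_assoc)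
  also have "\<dots> \<longleftrightarrow> (\<exists>u\<in>{0..int m - 1}. u = 1 \<and>
        (\<exists>x\<in>{0..int m - 1}. (0 < x \<and> int d * x < int m) \<and>
          (int d * x + int a * u) mod int m = 0))"
    by (rule bex_cong) (simp_all only: unit)
  also have "\<dots> \<longleftrightarrow> (\<exists>x\<in>{0..int m - 1}. (0 < x \<and> int d * x < int m) \<and>
          (int d * x + int a) mod int m = 0)"
    using one by (simp only: bex_one_point1 mult_1_right simp_thms)
  also have "\<dots> \<longleftrightarrow> (\<exists>x. 0 < x \<and> int d * x < int m \<and> int m dvd int d * x + int a)"
    unfolding dvd_eq_mod_eq_0 Bex_def by (intro iff_exI) (metis range)
  finally show ?thesis .
qed

lemma cong_iff_dvd_multiple:
  fixes a d p :: nat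
  assumes "0 < a" "a < d" "d < p"
  shows "[p = a] (mod d) \<longleftrightarrow>
    (\<exists>x. 0 < x \<and> int d * x < int p \<and> int p dvd int d * x + int a)"
proof
  assume "[p = a] (mod d)"
  then have "int d dvd int p - int a"
    by (metis cong_int_iff cong_iff_dvd_diff)
  \<comment> \<open>The witness is (p - a) / d: positive because a < p, and d * x = p - a < p
    because a > 0.\<close>
  then obtain x where x: "int p - int a = int d * x" ..
  moreover have "0 < int d * x"
    using x assms by linarith
  then have "0 < x"
    using assms by (simp add: zero_less_mult_iff)
  ultimately show "\<exists>x. 0 < x \<and> int d * x < int p \<and> int p dvd int d * x + int a"
    using assms by (intro exI[of _ x]) (auto simp flip: x)
next
  assume "\<exists>x. 0 < x \<and> int d * x < int p \<and> int p dvd int d * x + int a"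
  then obtain x k where x: "0 < x" "int d * x < int p" and k: "int d * x + int a = int p * k"
    by (auto simp: dvd_def)
  have "0 < int d * x"
    using x assms by simp
  \<comment> \<open>Both d * x and a are below p, which leaves k = 1 as the only multiple.\<close>
  then have "0 < int p * k" "int p * k < int p * 2"
    using k x assms by linarith+
  then have "k = 1"
    using assms by (simp add: zero_less_mult_iff)
  then have "int p - int a = int d * x"
    using k by simp
  then show "[p = a] (mod d)"
    by (metis cong_int_iff cong_iff_dvd_diff dvd_triv_left)
qed

theorem theorem5p18:
  fixes a d :: nat
  assumes "0 < a" and "0 < d" and "a < d"
  shows "\<exists>\<theta>. sentence \<theta> \<and>
    (\<forall>p::nat. prime p \<and> d < p \<longrightarrow> ([p = a] (mod d) \<longleftrightarrow> Zmod_models p \<theta>))"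
proof (intro exI[of _ "congruence_sentence a d"] conjI allI impI)
  show "sentence (congruence_sentence a d)"
    by (rule sentence_congruence_sentence)
next
  fix p :: nat
  assume p: "prime p \<and> d < p"
  then have "1 < p"
    using prime_gt_1_nat by blast
  \<comment> \<open>\<open>Zmod_models\<close> quantifies over all assignments into the carrier; one
    must exist, or it would hold vacuously.\<close>
  moreover have "\<exists>e::nat \<Rightarrow> int. \<forall>x. e x \<in> carrier (residue_ring (int p))"
    using \<open>1 < p\<close> by (intro exI[of _ "\<lambda>_. 0"]) (simp add: residue_ring_def)
  ultimately show "[p = a] (mod d) \<longleftrightarrow> Zmod_models p (congruence_sentence a d)"
    using assms p by (auto simp: Zmod_models_def sat_congruence_sentence cong_iff_dvd_multiple)
qed

end
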